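(* Let $G$ and $G'$ be second countable locally compact groups such that $G$ has property $(\mathrm{TTT})$ and $G'$ is a-TTT-menable. Then every quasi-homomorphism $q\colon G\to G'$ has relatively compact image in $G'$.
   Context: A map defined on a locally compact group is called locally bounded if it is bounded on every compact subset (for a map into a locally compact group $G'$: the image of every compact subset is relatively compact). A wq-cocycle on a locally compact group $G$ is a locally bounded Borel map $b\colon G\to\mathcal{H}$ into a Hilbert space $\mathcal{H}$, together with a Borel map $\pi\colon G\to\mathcal{U}(\mathcal{H})$ into the unitary group (no multiplicativity of $\pi$ is required), such that the defect is finite: $$\sup_{g,h\in G}\|b(gh)-(b(g)+\pi(g)b(h))\|<+\infty.$$ $G$ has property $(\mathrm{TTT})$ if every wq-cocycle on $G$ is bounded (i.e. $\sup_{g\in G}\|b(g)\|<\infty$). $G'$ is a-TTT-menable if there is a wq-cocycle $b$ on $G'$ that is proper, i.e. $\{g\in G' : \|b(g)\|\le C\}$ is relatively compact for every $C>0$. A quasi-homomorphism $q\colon G\to G'$ is a continuous map (or just a Borel and locally bounded map) such that the set $\{q(gh)^{-1}q(g)q(h) : g,h\in G\}$ is relatively compact in $G'$. *)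

theory Defs
  imports "HOL-Analysis.Analysis" "HOL-Algebra.Module"
begin

section \<open>Topological groups\<close>

definition topological_group :: "('g, 'm) monoid_scheme \<Rightarrow> 'g topology \<Rightarrow> bool" where
  "topological_group G T \<longleftrightarrow>
     group G \<and> topspace T = carrier G \<and>
     continuous_map (prod_topology T T) T (\<lambda>(x, y). x \<otimes>\<^bsub>G\<^esub> y) \<and>
     continuous_map T T (\<lambda>x. inv\<^bsub>G\<^esub> x)"

text \<open>As usual, locally compact groups are Hausdorff.\<close>

definition lcsc_group :: "('g, 'm) monoid_scheme \<Rightarrow> 'g topology \<Rightarrow> bool" where
  "lcsc_group G T \<longleftrightarrow>
     topological_group G T \<and> Hausdorff_space T \<and>
     locally_compact_space T \<and> second_countable T"

text \<open>The inclusion has to be stated, since \<open>closure_of\<close> ignores the points outside the space.\<close>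

definition relatively_compactin :: "'g topology \<Rightarrow> 'g set \<Rightarrow> bool" where
  "relatively_compactin T S \<longleftrightarrow> S \<subseteq> topspace T \<and> compactin T (T closure_of S)"

definition borel_of :: "'g topology \<Rightarrow> 'g measure" where
  "borel_of T = sigma (topspace T) {U. openin T U}"

section \<open>Complex Hilbert spaces\<close>

text \<open>
  A Hilbert space is a structure on a subset of an arbitrary type, given by a module over the
  complex numbers with an inner product that is linear in its first argument. The fields for
  the ring multiplication and its unit, which module records inherit, are not used.
\<close>

definition complex_ring :: "complex ring" where
  "complex_ring = \<lparr>carrier = UNIV, monoid.mult = (*), one = 1, zero = 0, add = (+)\<rparr>"

record 'h inner_module = "(complex, 'h) module" +
  cinner :: "'h \<Rightarrow> 'h \<Rightarrow> complex"

locale complex_inner_space = module complex_ring H for H :: "'h inner_module" (structure) +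
  assumes cinner_add_left:
      "\<lbrakk>x \<in> carrier H; y \<in> carrier H; z \<in> carrier H\<rbrakk> \<Longrightarrow>
        cinner H (x \<oplus> y) z = cinner H x z + cinner H y z"
    and cinner_smult_left:
      "\<lbrakk>x \<in> carrier H; y \<in> carrier H\<rbrakk> \<Longrightarrow> cinner H (a \<odot> x) y = a * cinner H x y"
    and cinner_commute:
      "\<lbrakk>x \<in> carrier H; y \<in> carrier H\<rbrakk> \<Longrightarrow> cinner H y x = cnj (cinner H x y)"
    and cinner_self_nonneg: "x \<in> carrier H \<Longrightarrow> 0 \<le> Re (cinner H x x)"
    and cinner_self_eq_0: "\<lbrakk>x \<in> carrier H; cinner H x x = 0\<rbrakk> \<Longrightarrow> x = \<zero>"

definition hnorm :: "'h inner_module \<Rightarrow> 'h \<Rightarrow> real" where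
  "hnorm H x = sqrt (Re (cinner H x x))"

text \<open>The locale \<open>Metric_space\<close> asks for symmetry and nonnegativity also outside the carrier.\<close>

definition hdist :: "'h inner_module \<Rightarrow> 'h \<Rightarrow> 'h \<Rightarrow> real" where
  "hdist H x y = (if x \<in> carrier H \<and> y \<in> carrier H then hnorm H (x \<ominus>\<^bsub>H\<^esub> y) else 0)"

context complex_inner_space
begin

lemma cinner_zero_left: "y \<in> carrier H \<Longrightarrow> cinner H \<zero> y = 0"
  using cinner_add_left[of "\<zero>" "\<zero>" y] by simp

lemma cinner_minus_left:
  assumes "x \<in> carrier H" "y \<in> carrier H"
  shows "cinner H (\<ominus> x) y = - cinner H x y"
  using cinner_add_left[of x "\<ominus> x" y] assms
  by (simp add: M.r_neg cinner_zero_left add_eq_0_iff)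

lemma cinner_minus_right:
  assumes "x \<in> carrier H" "y \<in> carrier H"
  shows "cinner H x (\<ominus> y) = - cinner H x y"
  using assms by (metis M.a_inv_closed cinner_commute cinner_minus_left complex_cnj_minus)

lemma cinner_add_right:
  assumes "x \<in> carrier H" "y \<in> carrier H" "z \<in> carrier H"
  shows "cinner H x (y \<oplus> z) = cinner H x y + cinner H x z"
  using assms by (metis M.a_closed cinner_add_left cinner_commute complex_cnj_add)

lemma smult_mem: "x \<in> carrier H \<Longrightarrow> a \<odot> x \<in> carrier H"
  by (simp add: complex_ring_def smult_closed)

lemma cinner_smult_right:
  assumes "x \<in> carrier H" "y \<in> carrier H"
  shows "cinner H x (a \<odot> y) = cnj a * cinner H x y"
  using assms by (metis smult_mem cinner_smult_left cinner_commute complex_cnj_mult)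

lemma Im_cinner_self: "x \<in> carrier H \<Longrightarrow> Im (cinner H x x) = 0"
  using cinner_commute[of x x] by (metis Reals_cnj_iff complex_is_Real_iff)

lemma hnorm_nonneg: "x \<in> carrier H \<Longrightarrow> 0 \<le> hnorm H x"
  by (simp add: hnorm_def cinner_self_nonneg)

lemma hnorm_power2: "x \<in> carrier H \<Longrightarrow> (hnorm H x)\<^sup>2 = Re (cinner H x x)"
  by (simp add: hnorm_def cinner_self_nonneg)

lemma hnorm_eq_0_iff: "x \<in> carrier H \<Longrightarrow> hnorm H x = 0 \<longleftrightarrow> x = \<zero>"
  using cinner_self_eq_0[of x] Im_cinner_self[of x]
  by (auto simp: hnorm_def complex_eq_iff cinner_zero_left)

lemma hnorm_minus: "x \<in> carrier H \<Longrightarrow> hnorm H (\<ominus> x) = hnorm H x"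
  by (simp add: hnorm_def cinner_minus_left cinner_minus_right)

lemma Cauchy_Schwarz:
  assumes x: "x \<in> carrier H" and y: "y \<in> carrier H"
  shows "cmod (cinner H x y) \<le> hnorm H x * hnorm H y"
proof (cases "y = \<zero>")
  case True
  then show ?thesis
    using x y cinner_commute[OF y x] by (simp add: cinner_zero_left hnorm_def)
next
  case False
  define n where "n = Re (cinner H y y)"
  define c where "c = cinner H x y"
  define a where "a = - c / of_real n"
  have n: "n > 0"
    using False y hnorm_eq_0_iff[of y] cinner_self_nonneg[of y] by (auto simp: hnorm_def n_def)
  have yy: "cinner H y y = of_real n"
    using Im_cinner_self[OF y] by (simp add: n_def complex_eq_iff)
  have "cinner H (x \<oplus> a \<odot> y) (x \<oplus> a \<odot> y) =
      cinner H x x + cnj a * c + a * cnj c + a * cnj a * of_real n"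
    using x y cinner_commute[OF x y] yy
    by (simp add: c_def smult_mem cinner_add_left cinner_add_right cinner_smult_left
        cinner_smult_right algebra_simps)
  also have "\<dots> = cinner H x x - c * cnj c / of_real n"
    using n by (simp add: a_def field_simps)
  also have "c * cnj c = of_real ((cmod c)\<^sup>2)"
    by (rule complex_norm_square[symmetric])
  finally have "Re (cinner H (x \<oplus> a \<odot> y) (x \<oplus> a \<odot> y)) = Re (cinner H x x) - (cmod c)\<^sup>2 / n"
    by (metis Re_complex_of_real minus_complex.sel(1) of_real_divide)
  then have "(cmod c)\<^sup>2 / n \<le> Re (cinner H x x)"
    using cinner_self_nonneg[of "x \<oplus> a \<odot> y"] x y by (simp add: smult_mem)
  then have "(cmod c)\<^sup>2 \<le> (hnorm H x * hnorm H y)\<^sup>2"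
    using n x y by (simp add: power_mult_distrib hnorm_power2 n_def field_simps)
  then show ?thesis
    unfolding c_def by (rule power2_le_imp_le) (simp add: hnorm_nonneg x y)
qed

lemma hnorm_triangle:
  assumes x: "x \<in> carrier H" and y: "y \<in> carrier H"
  shows "hnorm H (x \<oplus> y) \<le> hnorm H x + hnorm H y"
proof -
  have "(hnorm H (x \<oplus> y))\<^sup>2 = (hnorm H x)\<^sup>2 + 2 * Re (cinner H x y) + (hnorm H y)\<^sup>2"
    using x y cinner_commute[OF x y]
    by (simp add: hnorm_power2 cinner_add_left cinner_add_right)
  also have "Re (cinner H x y) \<le> hnorm H x * hnorm H y"
    using Cauchy_Schwarz[OF x y] complex_Re_le_cmod order_trans by blast
  finally have "(hnorm H (x \<oplus> y))\<^sup>2 \<le> (hnorm H x + hnorm H y)\<^sup>2"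
    by (simp add: power2_sum)
  then show ?thesis
    by (rule power2_le_imp_le) (simp add: hnorm_nonneg x y)
qed

lemma Metric_space_hdist: "Metric_space (carrier H) (hdist H)"
proof
  fix x y z
  show "0 \<le> hdist H x y"
    by (simp add: hdist_def hnorm_nonneg)
  show "hdist H x y = hdist H y x"
  proof (cases "x \<in> carrier H \<and> y \<in> carrier H")
    case True
    then have "x \<ominus> y = \<ominus> (y \<ominus> x)"
      by (simp add: a_minus_def M.minus_add M.a_comm)
    then show ?thesis
      using True by (simp add: hdist_def hnorm_minus)
  qed (auto simp: hdist_def)
  assume x: "x \<in> carrier H" and y: "y \<in> carrier H"
  show "hdist H x y = 0 \<longleftrightarrow> x = y"
    using x y M.minus_equality[of x "\<ominus> y"]
    by (auto simp: hdist_def hnorm_eq_0_iff a_minus_def M.r_neg)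
  assume z: "z \<in> carrier H"
  have "(x \<ominus> y) \<oplus> (y \<ominus> z) = x \<oplus> (\<ominus> y \<oplus> y) \<oplus> \<ominus> z"
    using x y z by (simp only: a_minus_def M.a_assoc M.a_closed M.a_inv_closed)
  also have "\<dots> = x \<ominus> z"
    using x y z by (simp add: M.l_neg a_minus_def)
  finally show "hdist H x z \<le> hdist H x y + hdist H y z"
    using hnorm_triangle[of "x \<ominus> y" "y \<ominus> z"] x y z by (simp add: hdist_def)
qed

end

locale complex_hilbert_space = complex_inner_space +
  assumes complete: "Metric_space.mcomplete (carrier H) (hdist H)"

definition htopology :: "'h inner_module \<Rightarrow> 'h topology" where
  "htopology H = Metric_space.mtopology (carrier H) (hdist H)"

definition unitary_group :: "'h inner_module \<Rightarrow> ('h \<Rightarrow> 'h) set" where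
  "unitary_group H =
     {u \<in> extensional (carrier H).
        bij_betw u (carrier H) (carrier H) \<and>
        (\<forall>x\<in>carrier H. \<forall>y\<in>carrier H. u (x \<oplus>\<^bsub>H\<^esub> y) = u x \<oplus>\<^bsub>H\<^esub> u y) \<and>
        (\<forall>a. \<forall>x\<in>carrier H. u (a \<odot>\<^bsub>H\<^esub> x) = a \<odot>\<^bsub>H\<^esub> u x) \<and>
        (\<forall>x\<in>carrier H. \<forall>y\<in>carrier H. cinner H (u x) (u y) = cinner H x y)}"

text \<open>The strong operator topology, i.e. the topology of pointwise convergence in norm.\<close>

definition unitary_topology :: "'h inner_module \<Rightarrow> ('h \<Rightarrow> 'h) topology" where
  "unitary_topology H =
     subtopology (product_topology (\<lambda>_. htopology H) (carrier H)) (unitary_group H)"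

section \<open>wq-cocycles and quasi-homomorphisms\<close>

definition wq_cocycle ::
  "('g, 'm) monoid_scheme \<Rightarrow> 'g topology \<Rightarrow> 'h inner_module \<Rightarrow>
     ('g \<Rightarrow> 'h) \<Rightarrow> ('g \<Rightarrow> 'h \<Rightarrow> 'h) \<Rightarrow> bool" where
  "wq_cocycle G T H b \<pi> \<longleftrightarrow>
     b \<in> borel_of T \<rightarrow>\<^sub>M borel_of (htopology H) \<and>
     (\<forall>K. compactin T K \<longrightarrow> (\<exists>C. \<forall>g\<in>K. hnorm H (b g) \<le> C)) \<and>
     \<pi> \<in> borel_of T \<rightarrow>\<^sub>M borel_of (unitary_topology H) \<and>
     (\<exists>D. \<forall>g\<in>carrier G. \<forall>h\<in>carrier G.
        hnorm H (b (g \<otimes>\<^bsub>G\<^esub> h) \<ominus>\<^bsub>H\<^esub> (b g \<oplus>\<^bsub>H\<^esub> \<pi> g (b h))) \<le> D)"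

text \<open>
  A formula of HOL cannot quantify over types. The type argument of the next two definitions
  is the universe in which the Hilbert spaces live: they range over all Hilbert spaces whose
  underlying set is a subset of the type \<open>'h\<close>.
\<close>

definition property_TTT ::
  "'h itself \<Rightarrow> ('g, 'm) monoid_scheme \<Rightarrow> 'g topology \<Rightarrow> bool" where
  "property_TTT (_ :: 'h itself) G T \<longleftrightarrow>
     (\<forall>(H :: 'h inner_module) b \<pi>.
        complex_hilbert_space H \<longrightarrow> wq_cocycle G T H b \<pi> \<longrightarrow>
        (\<exists>C. \<forall>g\<in>carrier G. hnorm H (b g) \<le> C))"

definition a_TTT_menable ::
  "'h itself \<Rightarrow> ('g, 'm) monoid_scheme \<Rightarrow> 'g topology \<Rightarrow> bool" where
  "a_TTT_menable (_ :: 'h itself) G T \<longleftrightarrow>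
     (\<exists>(H :: 'h inner_module) b \<pi>.
        complex_hilbert_space H \<and> wq_cocycle G T H b \<pi> \<and>
        (\<forall>C>0. relatively_compactin T {g \<in> carrier G. hnorm H (b g) \<le> C}))"

definition quasi_homomorphism ::
  "('g, 'm) monoid_scheme \<Rightarrow> 'g topology \<Rightarrow> ('k, 'n) monoid_scheme \<Rightarrow> 'k topology \<Rightarrow>
     ('g \<Rightarrow> 'k) \<Rightarrow> bool" where
  "quasi_homomorphism G T G' T' q \<longleftrightarrow>
     (continuous_map T T' q \<or>
      q \<in> borel_of T \<rightarrow>\<^sub>M borel_of T' \<and>
      (\<forall>K. compactin T K \<longrightarrow> relatively_compactin T' (q ` K))) \<and>
     relatively_compactin T'
       {inv\<^bsub>G'\<^esub> q (g \<otimes>\<^bsub>G\<^esub> h) \<otimes>\<^bsub>G'\<^esub> q g \<otimes>\<^bsub>G'\<^esub> q h | g h. g \<in> carrier G \<and> h \<in> carrier G}"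

end

theory Submission
  imports Defs
begin

text \<open>
  If \<open>(b, \<pi>)\<close> is a proper wq-cocycle on \<open>G'\<close>, then \<open>(b \<circ> q, \<pi> \<circ> q)\<close> is a wq-cocycle on \<open>G\<close>:
  writing \<open>q g q h = q (g h) d\<close> with \<open>d\<close> in a fixed relatively compact set, both
  \<open>b (q g) + \<pi> (q g) b (q h)\<close> and \<open>b (q (g h)) + \<pi> (q (g h)) b d\<close> are uniformly close to
  \<open>b (q g q h)\<close>, and \<open>\<pi> (q (g h)) b d\<close> is uniformly bounded because \<open>\<pi>\<close> is isometric and \<open>b\<close> is
  locally bounded. By property (TTT), \<open>b \<circ> q\<close> is bounded, so the image of \<open>q\<close> lies in a
  sublevel set of \<open>b\<close>, which is relatively compact.
\<close>

lemma relatively_compactin_subset: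
  assumes "relatively_compactin T S" "R \<subseteq> S"
  shows "relatively_compactin T R"
  using assms unfolding relatively_compactin_def
  by (meson closed_compactin closedin_closure_of closure_of_mono subset_trans)

lemma space_borel_of [simp]: "space (borel_of T) = topspace T"
  unfolding borel_of_def by (rule space_measure_of) (auto dest: openin_subset)

lemma continuous_map_measurable_borel_of:
  assumes "continuous_map T T' f"
  shows "f \<in> borel_of T \<rightarrow>\<^sub>M borel_of T'"
proof -
  have "f \<in> borel_of T \<rightarrow>\<^sub>M sigma (topspace T') {U. openin T' U}"
  proof (rule measurable_measure_of)
    show "{U. openin T' U} \<subseteq> Pow (topspace T')"
      by (auto dest: openin_subset)
    show "f \<in> space (borel_of T) \<rightarrow> topspace T'"
      using continuous_map_funspace[OF assms] by simp
    fix U assume "U \<in> {U. openin T' U}"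
    then have "openin T {x \<in> topspace T. f x \<in> U}"
      using assms by (simp add: continuous_map_def)
    moreover have "f -` U \<inter> space (borel_of T) = {x \<in> topspace T. f x \<in> U}"
      by auto
    moreover have "{U. openin T U} \<subseteq> Pow (topspace T)"
      by (auto dest: openin_subset)
    ultimately show "f -` U \<inter> space (borel_of T) \<in> sets (borel_of T)"
      by (simp add: borel_of_def sigma_sets.Basic)
  qed
  then show ?thesis
    by (simp add: borel_of_def)
qed

text \<open>Continuity makes preimages of open sets open, so both alternatives in the definition
  yield a Borel map.\<close>

lemma quasi_homomorphism_measurable:
  "quasi_homomorphism G T G' T' q \<Longrightarrow> q \<in> borel_of T \<rightarrow>\<^sub>M borel_of T'"
  by (auto simp: quasi_homomorphism_def continuous_map_measurable_borel_of)

text \<open>For continuous \<open>q\<close> the image of \<open>K\<close> is itself compact and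
  serves as \<open>L\<close>; in the Borel case \<open>L\<close> is the closure of that
  image.\<close>

lemma quasi_homomorphism_image_compactin:
  assumes "quasi_homomorphism G T G' T' q" "compactin T K"
  obtains L where "compactin T' L" "q ` K \<subseteq> L"
  using assms unfolding quasi_homomorphism_def relatively_compactin_def
  by (metis closure_of_subset image_compactin subset_refl)

context complex_inner_space
begin

lemma topspace_htopology: "topspace (htopology H) = carrier H"
  by (simp add: htopology_def Metric_space.topspace_mtopology Metric_space_hdist)

lemma topspace_unitary_topology: "topspace (unitary_topology H) \<subseteq> unitary_group H"
  by (auto simp: unitary_topology_def)

lemma unitary_group_closed: "u \<in> unitary_group H \<Longrightarrow> x \<in> carrier H \<Longrightarrow> u x \<in> carrier H"
  by (auto simp: unitary_group_def bij_betw_def)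

lemma unitary_group_hnorm: "u \<in> unitary_group H \<Longrightarrow> x \<in> carrier H \<Longrightarrow> hnorm H (u x) = hnorm H x"
  by (simp add: unitary_group_def hnorm_def)

text \<open>Used for the step from \<open>b (q (g h))\<close> to its translate by
  \<open>\<pi> (q (g h)) (b d)\<close>.\<close>

lemma hdist_add_right:
  assumes "x \<in> carrier H" "y \<in> carrier H"
  shows "hdist H x (x \<oplus> y) = hnorm H y"
proof -
  have "x \<ominus> (x \<oplus> y) = \<ominus> y"
    using assms by (simp add: a_minus_def M.minus_add M.a_assoc[symmetric] M.r_neg)
  then show ?thesis
    using assms by (simp add: hdist_def hnorm_minus)
qed

lemma wq_cocycle_comp_quasi_homomorphism:
  assumes G: "topological_group G T" and G': "topological_group G' T'"
    and b: "wq_cocycle G' T' H b \<pi>" and q: "quasi_homomorphism G T G' T' q"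
  shows "wq_cocycle G T H (b \<circ> q) (\<pi> \<circ> q)"
proof -
  interpret G: group G using G by (simp add: topological_group_def)
  interpret G': group G' using G' by (simp add: topological_group_def)
  interpret D: Metric_space "carrier H" "hdist H" by (rule Metric_space_hdist)
  have q_meas: "q \<in> borel_of T \<rightarrow>\<^sub>M borel_of T'"
    using q by (rule quasi_homomorphism_measurable)
  have b_meas: "b \<in> borel_of T' \<rightarrow>\<^sub>M borel_of (htopology H)"
    and \<pi>_meas: "\<pi> \<in> borel_of T' \<rightarrow>\<^sub>M borel_of (unitary_topology H)"
    and b_bdd: "\<And>K. compactin T' K \<Longrightarrow> \<exists>C. \<forall>g\<in>K. hnorm H (b g) \<le> C"
    using b by (auto simp: wq_cocycle_def)
  obtain D where D: "\<And>g h. g \<in> carrier G' \<Longrightarrow> h \<in> carrier G' \<Longrightarrow>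
      hnorm H (b (g \<otimes>\<^bsub>G'\<^esub> h) \<ominus> (b g \<oplus> \<pi> g (b h))) \<le> D"
    using b unfolding wq_cocycle_def by blast
  \<comment> \<open>A measurable map sends space into space, so the Borel conditions also place the
    values of \<open>q\<close>, \<open>b\<close> and \<open>\<pi>\<close> in the right
    carriers.\<close>
  have q_in: "q g \<in> carrier G'" if "g \<in> carrier G" for g
    using measurable_space[OF q_meas] that G G' by (simp add: topological_group_def)
  have b_in: "b g \<in> carrier H" if "g \<in> carrier G'" for g
    using measurable_space[OF b_meas] that G' by (simp add: topological_group_def topspace_htopology)
  have \<pi>_in: "\<pi> g \<in> unitary_group H" if "g \<in> carrier G'" for g
    using measurable_space[OF \<pi>_meas] that G' topspace_unitary_topology
    by (auto simp: topological_group_def)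
  define E where "E = {inv\<^bsub>G'\<^esub> q (g \<otimes>\<^bsub>G\<^esub> h) \<otimes>\<^bsub>G'\<^esub> q g \<otimes>\<^bsub>G'\<^esub> q h | g h. g \<in> carrier G \<and> h \<in> carrier G}"
  have "relatively_compactin T' E"
    using q by (simp add: quasi_homomorphism_def E_def)
  \<comment> \<open>Local boundedness of \<open>b\<close> speaks of compact sets only, so the bound
    on \<open>E\<close> is obtained from its closure.\<close>
  then have "compactin T' (T' closure_of E)" "E \<subseteq> T' closure_of E"
    by (auto simp: relatively_compactin_def closure_of_subset)
  then obtain C where C: "\<And>d. d \<in> E \<Longrightarrow> hnorm H (b d) \<le> C"
    using b_bdd by blast
  \<comment> \<open>\<open>C\<close> bounds the term \<open>\<pi> (q (g h)) (b d)\<close>; each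
    \<open>D\<close> is one use of the defect of \<open>b\<close>, at the pairs
    \<open>(q (g h), d)\<close> and \<open>(q g, q h)\<close>.\<close>
  have "hnorm H ((b \<circ> q) (g \<otimes>\<^bsub>G\<^esub> h) \<ominus> ((b \<circ> q) g \<oplus> (\<pi> \<circ> q) g ((b \<circ> q) h))) \<le> C + D + D"
    if g: "g \<in> carrier G" and h: "h \<in> carrier G" for g h
  proof -
    define d where "d = inv\<^bsub>G'\<^esub> q (g \<otimes>\<^bsub>G\<^esub> h) \<otimes>\<^bsub>G'\<^esub> q g \<otimes>\<^bsub>G'\<^esub> q h"
    have dE: "d \<in> E"
      unfolding d_def E_def using g h by blast
    have q: "q g \<in> carrier G'" "q h \<in> carrier G'" "q (g \<otimes>\<^bsub>G\<^esub> h) \<in> carrier G'"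
      using g h by (auto intro: q_in)
    then have d: "d \<in> carrier G'"
      by (simp add: d_def)
    \<comment> \<open>Two factorizations of one element: the defect bound of \<open>b\<close>
      applies to each, with the same left-hand term \<open>?w\<close>.\<close>
    have gh: "q (g \<otimes>\<^bsub>G\<^esub> h) \<otimes>\<^bsub>G'\<^esub> d = q g \<otimes>\<^bsub>G'\<^esub> q h"
      using q by (simp add: d_def G'.m_assoc[symmetric])
    let ?u = "b (q (g \<otimes>\<^bsub>G\<^esub> h))" and ?v = "b (q g) \<oplus> \<pi> (q g) (b (q h))"
    let ?w = "b (q g \<otimes>\<^bsub>G'\<^esub> q h)" and ?z = "\<pi> (q (g \<otimes>\<^bsub>G\<^esub> h)) (b d)"
    have in_H: "?u \<in> carrier H" "?v \<in> carrier H" "?w \<in> carrier H" "?z \<in> carrier H"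
      using q d by (simp_all add: b_in \<pi>_in unitary_group_closed)
    \<comment> \<open>The path runs from \<open>?u\<close> through \<open>?u \<oplus> ?z\<close> and
      \<open>?w\<close> to \<open>?v\<close>.\<close>
    have "hdist H ?u ?v \<le> hdist H ?u (?u \<oplus> ?z) + hdist H (?u \<oplus> ?z) ?w + hdist H ?w ?v"
      using D.triangle[of ?u "?u \<oplus> ?z" ?v] D.triangle[of "?u \<oplus> ?z" ?w ?v] in_H by simp
    moreover have "hdist H ?u (?u \<oplus> ?z) \<le> C"
      using in_H C[OF dE] q d by (simp add: hdist_add_right unitary_group_hnorm \<pi>_in b_in)
    moreover have "hdist H (?u \<oplus> ?z) ?w \<le> D"
      using D[OF q(3) d] in_H by (subst D.commute) (simp add: hdist_def gh)
    moreover have "hdist H ?w ?v \<le> D"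
      using D[OF q(1,2)] in_H by (simp add: hdist_def)
    ultimately show ?thesis
      using in_H by (simp add: hdist_def)
  qed
  moreover have "\<exists>C. \<forall>g\<in>K. hnorm H ((b \<circ> q) g) \<le> C" if K: "compactin T K" for K
  proof -
    obtain L where "compactin T' L" "q ` K \<subseteq> L"
      using quasi_homomorphism_image_compactin[OF q K] by blast
    then show ?thesis
      using b_bdd[of L] by fastforce
  qed
  ultimately show ?thesis
    unfolding wq_cocycle_def
    using measurable_comp[OF q_meas b_meas] measurable_comp[OF q_meas \<pi>_meas] by blast
qed

end

theorem theorem1:
  fixes G :: "('g, 'm) monoid_scheme" and T :: "'g topology"
    and G' :: "('k, 'n) monoid_scheme" and T' :: "'k topology"
    and q :: "'g \<Rightarrow> 'k"
  assumes "lcsc_group G T" and "lcsc_group G' T'"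
    and "property_TTT TYPE('h) G T"
    and "a_TTT_menable TYPE('h) G' T'"
    and "quasi_homomorphism G T G' T' q"
  shows "relatively_compactin T' (q ` carrier G)"
proof -
  have G: "topological_group G T" and G': "topological_group G' T'"
    using assms(1,2) by (auto simp: lcsc_group_def)
  obtain H :: "'h inner_module" and b \<pi>
    where H: "complex_hilbert_space H" and b: "wq_cocycle G' T' H b \<pi>"
      and proper: "\<And>C. C > 0 \<Longrightarrow> relatively_compactin T' {g \<in> carrier G'. hnorm H (b g) \<le> C}"
    using assms(4) unfolding a_TTT_menable_def by blast
  interpret complex_hilbert_space H by (rule H)
  have "wq_cocycle G T H (b \<circ> q) (\<pi> \<circ> q)"
    using G G' b assms(5) by (rule wq_cocycle_comp_quasi_homomorphism)
  \<comment> \<open>The pulled-back cocycle takes values in the same \<open>H\<close>, so property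
    (TTT) for the universe \<open>'h\<close> applies.\<close>
  then obtain C where C: "\<And>g. g \<in> carrier G \<Longrightarrow> hnorm H (b (q g)) \<le> C"
    using assms(3) H unfolding property_TTT_def comp_def by blast
  have "q g \<in> carrier G'" if "g \<in> carrier G" for g
    using measurable_space[OF quasi_homomorphism_measurable[OF assms(5)]] that G G'
    by (simp add: topological_group_def)
  \<comment> \<open>Properness concerns positive levels only, while \<open>C\<close> might be
    \<open>0\<close>; hence the maximum with \<open>1\<close>.\<close>
  then have "q ` carrier G \<subseteq> {g \<in> carrier G'. hnorm H (b g) \<le> max C 1}"
    using C by (auto simp: le_max_iff_disj)
  then show ?thesis
    using proper[of "max C 1"] relatively_compactin_subset by fastforce
qed

end
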